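(* For any rational flow $\phi(x,y)$ there exists a $1$-BIR $\ell$ of the form $$\ell(x,y)=\big(xA(x,y),\,yA(x,y)\big),$$ where $A\in\mathbb{R}(x,y)$ is a $0$-homogeneous rational function, such that $$\ell^{-1}\circ\phi\circ\ell(x,y)=\Big(\mathcal{U}(x,y),\ \frac{y}{y+1}\Big)$$ for some rational function $\mathcal{U}\in\mathbb{R}(x,y)$.
   Context: A rational flow is a pair $\phi=(u,v)$ of rational functions in $\mathbb{R}(x,y)$, $\phi\ne(x,y)$, satisfying, as identities of rational functions, $(1-z)\phi(\mathbf{x})=\phi\big(\phi(\mathbf{x}z)\frac{1-z}{z}\big)$ and $\lim_{z\to0}\phi(\mathbf{x}z)/z=\mathbf{x}$, where $\mathbf{x}=(x,y)$. A $1$-BIR is a birational plane transformation over $\mathbb{R}$ whose two coordinates are homogeneous rational functions of degree $1$. $0$-homogeneous means homogeneous of degree $0$. *)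

theory Defs
  imports
    Complex_Main
    "HOL-Computational_Algebra.Polynomial"
    "HOL-Computational_Algebra.Fraction_Field"
begin

text \<open>
  The field \<open>rat2\<close> is \<open>\<real>(x, y)\<close>, built as the fraction field of \<open>\<real>[x][y]\<close>: the inner
  polynomial variable is \<open>x\<close>, the outer one is \<open>y\<close>. The field \<open>rat3\<close> is
  \<open>\<real>(x, y, z) = \<real>(x, y)(z)\<close>.
\<close>

type_synonym rat2 = "real poly poly fract"
type_synonym rat3 = "rat2 poly fract"

definition const2 :: "real \<Rightarrow> rat2" where
  "const2 c = Fract [:[:c:]:] 1"

definition X :: rat2 where
  "X = Fract [:[:0, 1:]:] 1"

definition Y :: rat2 where
  "Y = Fract [:0, 1:] 1"

definition lift3 :: "rat2 \<Rightarrow> rat3" where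
  "lift3 r = Fract [:r:] 1"

definition const3 :: "real \<Rightarrow> rat3" where
  "const3 c = lift3 (const2 c)"

definition Z :: rat3 where
  "Z = Fract [:0, 1:] 1"

definition scale :: "'k::field \<Rightarrow> 'k \<times> 'k \<Rightarrow> 'k \<times> 'k" where
  "scale c w = (c * fst w, c * snd w)"

text \<open>
  In what follows \<open>emb\<close> is the embedding of \<open>\<real>\<close> into an extension field, namely \<^const>\<open>const2\<close> or
  \<^const>\<open>const3\<close>. The polynomial is evaluated at \<open>x = fst w\<close>, \<open>y = snd w\<close>.
\<close>

definition poly_at :: "(real \<Rightarrow> 'k::field) \<Rightarrow> real poly poly \<Rightarrow> 'k \<times> 'k \<Rightarrow> 'k" where
  "poly_at emb p w = poly (map_poly (\<lambda>c. poly (map_poly emb c) (fst w)) p) (snd w)"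

text \<open>
  \<open>subst_is emb r w s\<close>: the substitution \<open>r(w)\<close> is defined, i.e. \<open>r\<close> can be written with a
  denominator that does not vanish at \<open>w\<close>, and its value is \<open>s\<close>. The value does not depend on
  the chosen quotient. Using a relation keeps the convention \<open>a / 0 = 0\<close> out of compositions.
\<close>

definition subst_is :: "(real \<Rightarrow> 'k::field) \<Rightarrow> rat2 \<Rightarrow> 'k \<times> 'k \<Rightarrow> 'k \<Rightarrow> bool" where
  "subst_is emb r w s \<longleftrightarrow>
     (\<exists>p q. r = Fract p q \<and> poly_at emb q w \<noteq> 0 \<and> s = poly_at emb p w / poly_at emb q w)"

definition map_subst_is ::
  "(real \<Rightarrow> 'k::field) \<Rightarrow> rat2 \<times> rat2 \<Rightarrow> 'k \<times> 'k \<Rightarrow> 'k \<times> 'k \<Rightarrow> bool" where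
  "map_subst_is emb f w s \<longleftrightarrow>
     subst_is emb (fst f) w (fst s) \<and> subst_is emb (snd f) w (snd s)"

text \<open>\<open>comp_is f g h\<close>: the composition \<open>f \<circ> g\<close> of rational plane maps is defined and equals \<open>h\<close>.\<close>

definition comp_is :: "rat2 \<times> rat2 \<Rightarrow> rat2 \<times> rat2 \<Rightarrow> rat2 \<times> rat2 \<Rightarrow> bool" where
  "comp_is f g h \<longleftrightarrow> map_subst_is const2 f g h"

text \<open>
  The limit for \<open>z \<rightarrow> 0\<close> of a rational function in \<open>z\<close> over the field \<open>\<real>(x, y)\<close>: it exists in
  \<open>\<real>(x, y)\<close> iff the function is regular at \<open>z = 0\<close>, and then it is the value there.
\<close>

definition lim_Z_0_is :: "rat3 \<Rightarrow> rat2 \<Rightarrow> bool" where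
  "lim_Z_0_is r s \<longleftrightarrow>
     (\<exists>p q. r = Fract p q \<and> poly q 0 \<noteq> 0 \<and> s = poly p 0 / poly q 0)"

text \<open>Below, \<open>\<psi>\<close> is \<open>\<phi>(x z, y z)\<close>.\<close>

definition rational_flow :: "rat2 \<times> rat2 \<Rightarrow> bool" where
  "rational_flow \<phi> \<longleftrightarrow>
     \<phi> \<noteq> (X, Y) \<and>
     (\<exists>\<psi>. map_subst_is const3 \<phi> (scale Z (lift3 X, lift3 Y)) \<psi> \<and>
          map_subst_is const3 \<phi> (scale ((1 - Z) / Z) \<psi>)
            (scale (1 - Z) (lift3 (fst \<phi>), lift3 (snd \<phi>))) \<and>
          lim_Z_0_is (fst \<psi> / Z) X \<and> lim_Z_0_is (snd \<psi> / Z) Y)"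

text \<open>\<open>r(x z, y z) = z\<^sup>d r(x, y)\<close>\<close>

definition homogeneous :: "int \<Rightarrow> rat2 \<Rightarrow> bool" where
  "homogeneous d r \<longleftrightarrow>
     subst_is const3 r (scale Z (lift3 X, lift3 Y)) (Z powi d * lift3 r)"

definition birational_inverse :: "rat2 \<times> rat2 \<Rightarrow> rat2 \<times> rat2 \<Rightarrow> bool" where
  "birational_inverse l m \<longleftrightarrow> comp_is m l (X, Y) \<and> comp_is l m (X, Y)"

definition one_BIR :: "rat2 \<times> rat2 \<Rightarrow> bool" where
  "one_BIR l \<longleftrightarrow>
     (\<exists>m. birational_inverse l m) \<and> homogeneous 1 (fst l) \<and> homogeneous 1 (snd l)"

end

theory Submission
  imports Defs "Subresultants.More_Homomorphisms"
begin

text \<open>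
Write \<open>K = \<real>(x, y)\<close>. If \<open>W \<in> K\<close> is homogeneous of degree \<open>-1\<close> and \<open>W \<circ> \<phi> = W + 1\<close>, then
\<open>A = y W\<close> solves the problem: \<open>l = (x A, y A)\<close> has the inverse \<open>(x / A, y / A)\<close>, whose second
coordinate is \<open>1 / W\<close>; since \<open>W \<circ> l = W / A = 1 / y\<close>, the second coordinate of the conjugated
flow is \<open>1 / (W \<circ> \<phi> \<circ> l) = 1 / (1 / y + 1) = y / (y + 1)\<close>. So everything rests on finding such
a \<open>W\<close>, a rational function that measures the time along the flow.

It is read off from the roots of the flow in time. Take a coordinate \<open>f\<close> of \<open>\<phi>\<close> that is not
homogeneous of degree \<open>1\<close> and write the element \<open>r = f(x z, y z) / z\<close> of \<open>K(z)\<close> in lowest terms as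
\<open>P / Q\<close> with \<open>Q\<close> monic. After rescaling \<open>x\<close> and \<open>y\<close>, the translation equation says that composing
the coefficients of \<open>r\<close> with \<open>\<phi>\<close> replaces \<open>r(z)\<close> by \<open>r(1 + z)\<close>, and rescaling \<open>x\<close> and \<open>y\<close> by \<open>c\<close>
replaces \<open>r(z)\<close> by \<open>c r(c z)\<close>. Lowest terms are unique, so up to constants the same holds for \<open>P\<close>
and \<open>Q\<close> separately: their roots are shifted by \<open>-1\<close> by the flow and divided by \<open>c\<close> by the scaling.
If one of them has positive degree, the negative mean of its roots is the required \<open>W\<close>; it lies in
\<open>K\<close>, being a quotient of two coefficients up to an integer factor (\<open>exists_time_function\<close>). If
\<open>P\<close> and \<open>Q\<close> are both constant in \<open>z\<close>, then \<open>f\<close> is homogeneous of degree \<open>1\<close>. The condition at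
\<open>z = 0\<close> shows that this cannot be the case for both coordinates unless \<open>\<phi> = (x, y)\<close>
(\<open>coordinate_trivial\<close>).

For compositions to make sense, \<open>\<phi>\<close> must be dominant. This also follows from the condition at
\<open>z = 0\<close>: near the origin \<open>\<phi>\<close> is the identity to first order, so a polynomial relation between its
coordinates would force the lowest homogeneous part of that relation to vanish (\<open>flow_dominant\<close>).

Compositions with dominant maps are field homomorphisms out of \<open>K\<close>. An identity over \<open>K(z)\<close> is
handled through its values at real constants \<open>z = c\<close>: these are identities between
endomorphisms of \<open>K\<close>, and infinitely many of them determine a polynomial in \<open>z\<close>.
\<close>

hide_const (open) module.smult

section \<open>Fractions of polynomials in lowest terms\<close>

text \<open>
Coprimality in the form that is used below: no representation of \<open>P / Q\<close> has a denominator of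
smaller degree. Fixing \<open>Q\<close> to be monic makes the representation unique.
\<close>

definition lowest_terms :: "'a::field poly \<Rightarrow> 'a poly \<Rightarrow> bool" where
  "lowest_terms P Q \<longleftrightarrow>
     lead_coeff Q = 1 \<and> (\<forall>a b. b \<noteq> 0 \<longrightarrow> a * Q = P * b \<longrightarrow> degree Q \<le> degree b)"

lemma lowest_terms_exist:
  fixes p q :: "'a::field poly"
  assumes "q \<noteq> 0"
  obtains P Q where "lowest_terms P Q" "P * q = p * Q"
proof -
  have "q \<noteq> 0 \<and> (\<exists>a. a * q = p * q)"
    using assms by blast
  then obtain b where b: "b \<noteq> 0 \<and> (\<exists>a. a * q = p * b)"
    and min: "\<And>b'. b' \<noteq> 0 \<and> (\<exists>a. a * q = p * b') \<Longrightarrow> degree b \<le> degree b'"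
    using ex_has_least_nat[of "\<lambda>b. b \<noteq> 0 \<and> (\<exists>a. a * q = p * b)" q degree] by blast
  obtain a where a: "a * q = p * b"
    using b by blast
  define k where "k = inverse (lead_coeff b)"
  have k: "k \<noteq> 0"
    using b by (simp add: k_def)
  have PQ: "smult k a * q = p * smult k b"
    using a by simp
  have "degree (smult k b) \<le> degree b'" if "b' \<noteq> 0" "a' * smult k b = smult k a * b'" for a' b'
  proof -
    have "(a' * q) * smult k b = (smult k a * q) * b'"
      using that(2) by (metis mult.assoc mult.commute)
    also have "\<dots> = (p * b') * smult k b"
      using PQ by (metis mult.assoc mult.commute)
    finally have "(a' * q) * smult k b = (p * b') * smult k b" .
    moreover have "smult k b \<noteq> 0"
      using b k by simp
    ultimately have "a' * q = p * b'"
      using mult_right_cancel by blast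
    then show ?thesis
      using min that(1) k by auto
  qed
  moreover have "lead_coeff (smult k b) = 1"
    using b by (simp add: k_def)
  ultimately have "lowest_terms (smult k a) (smult k b)"
    unfolding lowest_terms_def by blast
  then show thesis
    using that PQ by blast
qed

text \<open>
Two fractions with the same value also have the same value as the quotient of the differences of
their numerators and denominators. As both denominators are monic of the same degree, that quotient
would have a denominator of smaller degree.
\<close>

lemma lowest_terms_unique:
  assumes "lowest_terms P Q" "lead_coeff Q' = 1" "degree Q' = degree Q" "P' * Q = P * Q'"
  shows "P' = P \<and> Q' = Q"
proof -
  have Q: "lead_coeff Q = 1" "Q \<noteq> 0"
    using assms(1) by (auto simp: lowest_terms_def)
  have "Q' = Q"
  proof (rule ccontr)
    assume "Q' \<noteq> Q"
    moreover have "(P' - P) * Q = P * (Q' - Q)"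
      using assms(4) by (simp add: algebra_simps)
    ultimately have "degree Q \<le> degree (Q' - Q)"
      using assms(1) unfolding lowest_terms_def by (metis right_minus_eq)
    moreover have "degree (Q' - Q) \<le> degree Q" "coeff (Q' - Q) (degree Q) = 0"
      using assms(2,3) Q(1) by (auto intro: degree_diff_le)
    ultimately have "degree (Q' - Q) = degree Q"
      by simp
    with \<open>coeff (Q' - Q) (degree Q) = 0\<close> have "lead_coeff (Q' - Q) = 0"
      by (simp only:)
    with \<open>Q' \<noteq> Q\<close> show False
      by (simp only: leading_coeff_0_iff right_minus_eq)
  qed
  with assms(4) Q(2) show ?thesis
    by simp
qed

text \<open>
An invertible affine substitution can be undone, so it cannot create a common factor. The power of
\<open>b\<close> makes the new denominator monic.
\<close>

lemma lowest_terms_pcompose_linear: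
  fixes P Q :: "'a::field poly"
  assumes "lowest_terms P Q" "b \<noteq> 0" "k \<noteq> 0"
  shows "lowest_terms (smult (k / b ^ degree Q) (P \<circ>\<^sub>p [:a, b:]))
           (smult (1 / b ^ degree Q) (Q \<circ>\<^sub>p [:a, b:]))"
    (is "lowest_terms ?P ?Q")
proof -
  define l m where "l = [:a, b:]" and "m = [:- a / b, 1 / b:]"
  have deg: "degree l = 1" "degree m = 1"
    using assms(2) by (simp_all add: l_def m_def)
  have inv: "r \<circ>\<^sub>p l \<circ>\<^sub>p m = r" for r
  proof -
    have "l \<circ>\<^sub>p m = [:0, 1:]"
      using assms(2) by (simp add: l_def m_def pcompose_pCons)
    then show ?thesis
      by (metis pcompose_assoc pcompose_idR)
  qed
  have "degree ?Q \<le> degree d" if "d \<noteq> 0" "c * ?Q = ?P * d" for c d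
  proof -
    have "smult (b ^ degree Q) (c * ?Q) = smult (b ^ degree Q) (?P * d)"
      using that(2) by simp
    then have "c * Q \<circ>\<^sub>p l = smult k (P \<circ>\<^sub>p l * d)"
      using assms(2) by (simp add: l_def)
    then have "(c * Q \<circ>\<^sub>p l) \<circ>\<^sub>p m = smult k (P \<circ>\<^sub>p l * d) \<circ>\<^sub>p m"
      by simp
    then have "c \<circ>\<^sub>p m * Q = smult k (P * d \<circ>\<^sub>p m)"
      by (simp only: pcompose_mult pcompose_smult inv)
    then have "smult (1 / k) (c \<circ>\<^sub>p m) * Q = P * d \<circ>\<^sub>p m"
      using assms(3) by simp
    moreover have "d \<circ>\<^sub>p m \<noteq> 0"
      using that(1) deg by (simp add: pcompose_eq_0_iff)
    ultimately have "degree Q \<le> degree (d \<circ>\<^sub>p m)"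
      using assms(1) unfolding lowest_terms_def by blast
    then show ?thesis
      using assms(2) deg by (simp flip: l_def add: degree_pcompose)
  qed
  moreover have "lead_coeff ?Q = 1"
    using assms(1,2) lead_coeff_comp[of "[:a, b:]" Q]
    by (simp add: lowest_terms_def degree_pcompose)
  ultimately show ?thesis
    unfolding lowest_terms_def by blast
qed

section \<open>The mean of the roots of a polynomial\<close>

text \<open>
By Vieta, this is minus the mean of the roots in an algebraic closure, counted with multiplicity.
\<close>

definition neg_root_mean :: "'a::field poly \<Rightarrow> 'a" where
  "neg_root_mean P = coeff P (degree P - 1) / (of_nat (degree P) * lead_coeff P)"

lemma coeff_pcompose_affine:
  fixes P :: "'a::comm_ring_1 poly"
  shows "coeff (P \<circ>\<^sub>p [:a, b:]) i =
    (\<Sum>j\<le>degree P. coeff P j * (of_nat (j choose i) * b ^ i * a ^ (j - i)))"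
proof -
  have "P \<circ>\<^sub>p [:a, b:] = (\<Sum>j\<le>degree P. smult (coeff P j) ([:a, b:] ^ j))"
    by (simp add: pcompose_altdef poly_altdef degree_map_poly coeff_map_poly)
  moreover have "coeff ([:a, b:] ^ j) i = of_nat (j choose i) * b ^ i * a ^ (j - i)" for j
    by (cases "i \<le> j")
      (auto simp: coeff_linear_poly_power binomial_eq_0
        intro!: coeff_eq_0 intro: le_less_trans[OF degree_power_le])
  ultimately show ?thesis
    by (simp add: coeff_sum)
qed

text \<open>
If \<open>r\<close> runs through the roots of \<open>P\<close>, then \<open>(r - a) / b\<close> runs through the roots of \<open>P(a + b x)\<close>,
and the mean of the roots is transformed accordingly. Comparing the two leading coefficients proves
this without mentioning roots.
\<close>

lemma neg_root_mean_map_poly: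
  fixes P :: "'a::field poly"
  assumes "field_hom h" "map_poly h P = smult k (P \<circ>\<^sub>p [:a, b:])" "b \<noteq> 0"
    and d: "degree P > 0" "(of_nat (degree P) :: 'a) \<noteq> 0"
  shows "h (neg_root_mean P) = (neg_root_mean P + a) / b"
proof -
  interpret field_hom h by fact
  obtain m where m: "degree P = Suc m"
    using d(1) gr0_implies_Suc by blast
  have P: "P \<noteq> 0"
    using d(1) by auto
  have top: "(\<Sum>j\<le>Suc m. coeff P j * (of_nat (j choose Suc m) * b ^ Suc m * a ^ (j - Suc m))) =
      (\<Sum>j\<in>{Suc m}. coeff P j * (of_nat (j choose Suc m) * b ^ Suc m * a ^ (j - Suc m)))"
    by (rule sum.mono_neutral_right) (auto simp: binomial_eq_0)
  have "coeff (map_poly h P) (Suc m) = k * b ^ Suc m * lead_coeff P"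
    unfolding assms(2) coeff_smult coeff_pcompose_affine m top by simp
  then have 1: "h (lead_coeff P) = k * b ^ Suc m * lead_coeff P"
    using m by simp
  have next_to_top: "(\<Sum>j\<le>Suc m. coeff P j * (of_nat (j choose m) * b ^ m * a ^ (j - m))) =
      (\<Sum>j\<in>{m, Suc m}. coeff P j * (of_nat (j choose m) * b ^ m * a ^ (j - m)))"
    by (rule sum.mono_neutral_right) (auto simp: binomial_eq_0)
  have "coeff (map_poly h P) m = k * b ^ m * (coeff P m + of_nat (Suc m) * lead_coeff P * a)"
    unfolding assms(2) coeff_smult coeff_pcompose_affine m next_to_top
    by (simp add: algebra_simps)
  then have 2: "h (coeff P m) = k * b ^ m * (coeff P m + of_nat (Suc m) * lead_coeff P * a)"
    by simp
  have "h (lead_coeff P) \<noteq> 0"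
    using P by simp
  then have "k \<noteq> 0"
    using 1 by auto
  have hN: "h (of_nat (Suc m)) = of_nat (Suc m)"
    by (rule hom_of_nat)
  define N :: 'a where "N = of_nat (Suc m)"
  have "N \<noteq> 0" "h N = N"
    using d(2) hN by (simp_all add: N_def m)
  have mean: "neg_root_mean P = coeff P m / (N * lead_coeff P)"
    by (simp add: neg_root_mean_def N_def m)
  have "h (neg_root_mean P) = h (coeff P m) / (N * h (lead_coeff P))"
    unfolding mean by (simp only: hom_div hom_mult \<open>h N = N\<close>)
  also have "\<dots> = (coeff P m / (N * lead_coeff P) + a) / b"
    unfolding 1 2 N_def[symmetric] using \<open>k \<noteq> 0\<close> assms(3) P \<open>N \<noteq> 0\<close>
    by (simp add: field_simps)
  finally show ?thesis
    unfolding mean .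
qed

section \<open>Evaluation of real polynomials in two variables\<close>

interpretation const2: field_hom const2
  by unfold_locales (simp_all add: const2_def fract_collapse)

interpretation lift3: field_hom lift3
  by unfold_locales (auto simp: lift3_def fract_collapse intro: arg_cong2[where f = Fract] mult.commute)

interpretation const3: field_hom const3
  by unfold_locales (simp_all add: const3_def hom_distribs)

lemma poly_at_comm_ring_hom:
  assumes "field_hom emb"
  shows "comm_ring_hom (\<lambda>p. poly_at emb p w)"
proof -
  interpret emb: field_hom emb by fact
  interpret emb_poly: map_poly_comm_ring_hom emb ..
  interpret inner: comm_ring_hom "\<lambda>c. poly (map_poly emb c) (fst w)"
    by unfold_locales (simp_all add: hom_distribs)
  interpret inner_poly: map_poly_comm_ring_hom "\<lambda>c. poly (map_poly emb c) (fst w)" ..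
  show ?thesis
    unfolding poly_at_def by unfold_locales (simp_all add: hom_distribs)
qed

lemma poly_at_monom:
  assumes "field_hom emb"
  shows "poly_at emb (monom (monom c i) j) (a, b) = emb c * a ^ i * b ^ j"
proof -
  interpret emb: field_hom emb by fact
  show ?thesis
    by (simp add: poly_at_def map_poly_monom poly_monom)
qed

lemma poly_at_field_hom:
  assumes "field_hom emb" "field_hom h"
  shows "h (poly_at emb p w) = poly_at (\<lambda>c. h (emb c)) p (h (fst w), h (snd w))"
proof -
  interpret emb: field_hom emb by fact
  interpret h: field_hom h by fact
  have "h (poly (map_poly emb c) (fst w)) = poly (map_poly (\<lambda>c. h (emb c)) c) (h (fst w))" for c
    by (simp add: map_poly_map_poly o_def flip: h.poly_map_poly)
  then show ?thesis
    by (simp add: poly_at_def map_poly_map_poly o_def flip: h.poly_map_poly)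
qed

text \<open>
The generic point: \<open>\<real>[x, y]\<close> embeds into its field of fractions.
\<close>

lemma poly_at_X_Y: "poly_at const2 p (X, Y) = Fract p 1"
proof -
  have inner: "poly (map_poly const2 c) X = Fract [:c:] 1" for c
  proof (induction c)
    case (pCons t c)
    have "Fract [:pCons t c:] 1 = const2 t + X * Fract [:c:] 1"
      by (simp add: X_def const2_def)
    then show ?case
      by (simp only: const2.map_poly_pCons_hom poly_pCons pCons.IH)
  qed (simp add: fract_collapse)
  have 0: "(\<lambda>c. Fract [:c:] 1 :: rat2) 0 = 0"
    by (simp add: fract_collapse)
  have "poly (map_poly (\<lambda>c. Fract [:c:] 1) p) Y = Fract p 1"
  proof (induction p)
    case (pCons c p)
    have "Fract (pCons c p) 1 = Fract [:c:] 1 + Y * Fract p 1"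
      by (simp add: Y_def)
    then show ?case
      by (simp only: Polynomial.map_poly_pCons[where f = "\<lambda>c. Fract [:c:] 1", OF 0] poly_pCons pCons.IH)
  qed (simp add: fract_collapse)
  then show ?thesis
    by (simp add: poly_at_def inner)
qed

definition homogeneous_part :: "nat \<Rightarrow> real poly poly \<Rightarrow> real poly poly" where
  "homogeneous_part k p = (\<Sum>j\<le>k. monom (monom (coeff (coeff p j) (k - j)) (k - j)) j)"

text \<open>
Any upper bound of the total degree is good enough for the decomposition into homogeneous parts.
\<close>

definition degree_bound :: "real poly poly \<Rightarrow> nat" where
  "degree_bound p = degree p + (\<Sum>j\<le>degree p. degree (coeff p j))"

lemma coeff_homogeneous_part:
  "coeff (coeff (homogeneous_part k p) j) i = (if i + j = k then coeff (coeff p j) i else 0)"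
proof -
  have "coeff (coeff (homogeneous_part k p) j) i
      = (\<Sum>j'\<le>k. if j' = j then (if k - j' = i then coeff (coeff p j') (k - j') else 0) else 0)"
    unfolding homogeneous_part_def coeff_sum by (intro sum.cong) auto
  also have "\<dots> = (if i + j = k then coeff (coeff p j) i else 0)"
    by (subst sum.delta) auto
  finally show ?thesis .
qed

lemma coeff_eq_0_degree_bound:
  assumes "degree_bound p < i + j"
  shows "coeff (coeff p j) i = 0"
proof (cases "j \<le> degree p")
  case True
  then have "degree (coeff p j) \<le> (\<Sum>j\<le>degree p. degree (coeff p j))"
    by (intro member_le_sum) auto
  with assms True have "degree (coeff p j) < i"
    unfolding degree_bound_def by linarith
  then show ?thesis
    by (rule coeff_eq_0)
qed (simp add: coeff_eq_0)

lemma sum_homogeneous_part: "(\<Sum>k\<le>degree_bound p. homogeneous_part k p) = p"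
  by (intro poly_eqI)
    (auto simp: coeff_sum coeff_homogeneous_part coeff_eq_0_degree_bound not_le)

lemma poly_at_homogeneous_part_scale:
  assumes "field_hom emb"
  shows "poly_at emb (homogeneous_part k p) (z * a, z * b) = z ^ k * poly_at emb (homogeneous_part k p) (a, b)"
proof -
  interpret comm_ring_hom "\<lambda>p. poly_at emb p w" for w
    using assms by (rule poly_at_comm_ring_hom)
  have "emb c * (z * a) ^ (k - j) * (z * b) ^ j = z ^ k * (emb c * a ^ (k - j) * b ^ j)"
    if "j \<le> k" for c j
  proof -
    have "z ^ k = z ^ (k - j) * z ^ j"
      using that by (simp flip: power_add)
    then show ?thesis
      by (simp add: power_mult_distrib ac_simps)
  qed
  then show ?thesis
    unfolding homogeneous_part_def hom_sum poly_at_monom[OF assms] sum_distrib_left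
    by (intro sum.cong) auto
qed

lemma poly_at_scale:
  assumes "field_hom emb"
  shows "poly_at emb p (z * a, z * b) =
    (\<Sum>k\<le>degree_bound p. z ^ k * poly_at emb (homogeneous_part k p) (a, b))"
proof -
  interpret comm_ring_hom "\<lambda>p. poly_at emb p w" for w
    using assms by (rule poly_at_comm_ring_hom)
  have "poly_at emb p (z * a, z * b) = (\<Sum>k\<le>degree_bound p. poly_at emb (homogeneous_part k p) (z * a, z * b))"
    by (subst sum_homogeneous_part[of p, symmetric]) (rule hom_sum)
  then show ?thesis
    by (simp add: poly_at_homogeneous_part_scale[OF assms])
qed

text \<open>
The polynomial \<open>p(z a, z b)\<close> in \<open>z\<close>. It interpolates between substitutions over \<open>\<real>(x, y)\<close>, where
\<open>z\<close> is any element, and the substitution over \<open>\<real>(x, y, z)\<close>, where \<open>z\<close> is the variable.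
\<close>

definition scale_poly :: "real poly poly \<Rightarrow> rat2 \<times> rat2 \<Rightarrow> rat2 poly" where
  "scale_poly p w = (\<Sum>k\<le>degree_bound p. monom (poly_at const2 (homogeneous_part k p) w) k)"

lemma poly_scale_poly: "poly (scale_poly p (a, b)) e = poly_at const2 p (e * a, e * b)"
  by (simp add: scale_poly_def poly_sum poly_monom poly_at_scale[OF const2.field_hom_axioms])
    (simp only: mult.commute)

lemma Z_power_mult_lift3: "Z ^ k * lift3 t = Fract (monom t k) 1"
proof -
  have "Z ^ k = Fract ([:0, 1:] ^ k) 1"
    by (induction k) (simp_all add: Z_def One_fract_def)
  then show ?thesis
    by (simp add: lift3_def monom_altdef)
qed

lemma sum_Fract: "(\<Sum>k\<in>A. Fract (f k) 1) = Fract (\<Sum>k\<in>A. f k) 1"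
  by (induction A rule: infinite_finite_induct) (simp_all add: fract_collapse)

lemma poly_at_scale_Z:
  "poly_at const3 p (Z * lift3 a, Z * lift3 b) = Fract (scale_poly p (a, b)) 1"
proof -
  have "poly_at const3 q (lift3 a, lift3 b) = lift3 (poly_at const2 q (a, b))" for q
    using poly_at_field_hom[OF const2.field_hom_axioms lift3.field_hom_axioms, of q "(a, b)"]
    by (simp add: const3_def[abs_def])
  then show ?thesis
    by (simp add: poly_at_scale[OF const3.field_hom_axioms] Z_power_mult_lift3 scale_poly_def sum_Fract)
qed

text \<open>
Identities between values are derived by dividing by expressions in \<open>c\<close>, and the finitely many
zeros of these have to be left out.
\<close>

lemma poly_eqI_const2:
  fixes p q :: "rat2 poly"
  assumes "finite B" "\<And>c. c \<notin> B \<Longrightarrow> poly p (const2 c) = poly q (const2 c)"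
  shows "p = q"
proof (rule ccontr)
  assume "p \<noteq> q"
  then have "finite {x. poly (p - q) x = 0}"
    by (intro poly_roots_finite) simp
  moreover have "const2 ` (- B) \<subseteq> {x. poly (p - q) x = 0}"
    using assms(2) by auto
  ultimately have "finite (const2 ` (- B))"
    by (rule rev_finite_subset)
  then have "finite (- B)"
    by (rule finite_imageD) (simp add: inj_on_def)
  with assms(1) have "finite (UNIV :: real set)"
    by (metis Compl_partition finite_UnI)
  then show False
    using infinite_UNIV_char_0 by blast
qed

section \<open>Values of rational functions of \<open>z\<close>\<close>

text \<open>
The specialisation \<open>z = e\<close> as a relation, defined for the functions that are regular at \<open>e\<close>. For
\<open>e = 0\<close> it is the limit condition of a rational flow.
\<close>

definition value_at :: "'a::field \<Rightarrow> 'a poly fract \<Rightarrow> 'a \<Rightarrow> bool" where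
  "value_at e r s \<longleftrightarrow> (\<exists>p q. r = Fract p q \<and> poly q e \<noteq> 0 \<and> s = poly p e / poly q e)"

lemma lim_Z_0_is_iff: "lim_Z_0_is r s \<longleftrightarrow> value_at 0 r s"
  by (simp add: lim_Z_0_is_def value_at_def)

text \<open>
The equation is free of denominators, and at a common root of \<open>P\<close> and \<open>Q\<close> it reads \<open>0 = 0\<close>. So
it holds for every representation of a rational function.
\<close>

lemma value_at_Fract:
  assumes "value_at e (Fract P Q) s" "Q \<noteq> 0"
  shows "poly P e = s * poly Q e"
proof -
  obtain p q where pq: "Fract P Q = Fract p q" "poly q e \<noteq> 0" "s = poly p e / poly q e"
    using assms(1) by (auto simp: value_at_def)
  then have "P * q = p * Q"
    using assms(2) by (subst (asm) eq_fract) auto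
  then have "poly P e * poly q e = poly p e * poly Q e"
    by (metis poly_mult)
  also have "\<dots> = s * poly Q e * poly q e"
    using pq(2,3) by simp
  finally show ?thesis
    using pq(2) by simp
qed

lemma value_at_unique:
  assumes "value_at e r s" "value_at e r s'"
  shows "s = s'"
proof -
  obtain p q where pq: "r = Fract p q" "poly q e \<noteq> 0" "s = poly p e / poly q e"
    using assms(1) by (auto simp: value_at_def)
  then have "poly p e = s' * poly q e"
    using assms(2) by (intro value_at_Fract) auto
  then show ?thesis
    using pq by simp
qed

lemma value_at_poly: "value_at e (Fract p 1) (poly p e)"
  unfolding value_at_def by (intro exI[of _ p] exI[of _ 1]) simp

lemma value_at_add:
  assumes "value_at e r s" "value_at e r' s'"
  shows "value_at e (r + r') (s + s')"
proof -
  obtain p q p' q' where "r = Fract p q" "poly q e \<noteq> 0" "s = poly p e / poly q e"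
    "r' = Fract p' q'" "poly q' e \<noteq> 0" "s' = poly p' e / poly q' e"
    using assms by (auto simp: value_at_def)
  moreover from this have "q \<noteq> 0" "q' \<noteq> 0"
    by auto
  ultimately show ?thesis
    unfolding value_at_def
    by (intro exI[of _ "p * q' + p' * q"] exI[of _ "q * q'"]) (simp add: add_frac_eq)
qed

lemma value_at_mult:
  assumes "value_at e r s" "value_at e r' s'"
  shows "value_at e (r * r') (s * s')"
proof -
  obtain p q p' q' where "r = Fract p q" "poly q e \<noteq> 0" "s = poly p e / poly q e"
    "r' = Fract p' q'" "poly q' e \<noteq> 0" "s' = poly p' e / poly q' e"
    using assms by (auto simp: value_at_def)
  then show ?thesis
    unfolding value_at_def by (intro exI[of _ "p * p'"] exI[of _ "q * q'"]) simp
qed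

lemma value_at_divide:
  assumes "value_at e r s" "value_at e r' s'" "s' \<noteq> 0"
  shows "value_at e (r / r') (s / s')"
proof -
  obtain p q p' q' where "r = Fract p q" "poly q e \<noteq> 0" "s = poly p e / poly q e"
    "r' = Fract p' q'" "poly q' e \<noteq> 0" "s' = poly p' e / poly q' e"
    using assms by (auto simp: value_at_def)
  then show ?thesis
    using assms(3) unfolding value_at_def
    by (intro exI[of _ "p * q'"] exI[of _ "q * p'"]) simp
qed

lemma value_at_sum:
  assumes "\<And>k. k \<in> A \<Longrightarrow> value_at e (f k) (g k)"
  shows "value_at e (sum f A) (sum g A)"
proof -
  have "value_at e 0 0"
    using value_at_poly[of e 0] by (simp add: fract_collapse)
  with assms show ?thesis
    by (induction A rule: infinite_finite_induct) (auto intro: value_at_add)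
qed

lemma value_at_power: "value_at e r s \<Longrightarrow> value_at e (r ^ k) (s ^ k)"
  using value_at_poly[of e 1] by (induction k) (auto intro: value_at_mult simp: fract_collapse)

lemma value_at_lift3: "value_at e (lift3 c) c"
  using value_at_poly[of e "[:c:]"] by (simp add: lift3_def)

lemma value_at_Z: "value_at e Z e"
  using value_at_poly[of e "[:0, 1:]"] by (simp add: Z_def)

lemma value_at_poly_at:
  assumes "value_at e a a'" "value_at e b b'"
  shows "value_at e (poly_at const3 p (a, b)) (poly_at const2 p (a', b'))"
proof -
  define f g where "f c = poly (map_poly const3 c) a" and "g c = poly (map_poly const2 c) a'" for c
  have fg: "value_at e (f c) (g c)" for c
  proof (induction c)
    case 0
    then show ?case
      using value_at_lift3[of e 0] by (simp add: f_def g_def)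
  next
    case (pCons t c)
    have "value_at e (const3 t + a * f c) (const2 t + a' * g c)"
      unfolding const3_def
      by (intro value_at_add value_at_mult value_at_lift3 assms(1) pCons.IH)
    then show ?case
      by (simp add: f_def g_def const2.map_poly_pCons_hom const3.map_poly_pCons_hom)
  qed
  have [simp]: "f 0 = 0" "g 0 = 0"
    by (simp_all add: f_def g_def)
  have "value_at e (poly (map_poly f p) b) (poly (map_poly g p) b')"
  proof (induction p)
    case 0
    then show ?case
      using value_at_lift3[of e 0] by simp
  next
    case (pCons t p)
    have "value_at e (f t + b * poly (map_poly f p) b) (g t + b' * poly (map_poly g p) b')"
      by (intro value_at_add value_at_mult fg assms(2) pCons.IH)
    then show ?case
      by (simp add: Polynomial.map_poly_pCons[where f = f] Polynomial.map_poly_pCons[where f = g])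
  qed
  then show ?thesis
    by (simp add: poly_at_def f_def[abs_def] g_def[abs_def])
qed

section \<open>Substitution homomorphisms\<close>

text \<open>
A point is dominant if its coordinates are algebraically independent. Exactly then every rational
function can be substituted.
\<close>

definition dominant :: "(real \<Rightarrow> 'k::field) \<Rightarrow> 'k \<times> 'k \<Rightarrow> bool" where
  "dominant emb w \<longleftrightarrow> (\<forall>p. p \<noteq> 0 \<longrightarrow> poly_at emb p w \<noteq> 0)"

definition pullback :: "(real \<Rightarrow> 'k::field) \<Rightarrow> 'k \<times> 'k \<Rightarrow> rat2 \<Rightarrow> 'k" where
  "pullback emb w r = (THE s. subst_is emb r w s)"

text \<open>
Field homomorphisms out of \<open>\<real>(x, y)\<close> that extend a given embedding of \<open>\<real>\<close>. They are the
substitutions of dominant points, see \<open>extends_pullback\<close> and \<open>extends_eq_pullback\<close>, and so two of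
them are equal once they agree on \<open>x\<close> and \<open>y\<close>.
\<close>

definition extends :: "(real \<Rightarrow> 'k::field) \<Rightarrow> (rat2 \<Rightarrow> 'k) \<Rightarrow> bool" where
  "extends emb h \<longleftrightarrow> field_hom h \<and> (\<forall>c. h (const2 c) = emb c)"

lemma subst_is_Fract:
  assumes "field_hom emb" "subst_is emb (Fract P Q) w s" "Q \<noteq> 0"
  shows "poly_at emb P w = s * poly_at emb Q w"
proof -
  interpret ev: comm_ring_hom "\<lambda>p. poly_at emb p w"
    using assms(1) by (rule poly_at_comm_ring_hom)
  obtain p q where pq: "Fract P Q = Fract p q" "poly_at emb q w \<noteq> 0"
    "s = poly_at emb p w / poly_at emb q w"
    using assms(2) by (auto simp: subst_is_def)
  then have "q \<noteq> 0"
    by auto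
  then have "P * q = p * Q"
    using pq(1) assms(3) by (simp add: eq_fract)
  then have "poly_at emb P w * poly_at emb q w = poly_at emb p w * poly_at emb Q w"
    by (metis ev.hom_mult)
  also have "\<dots> = s * poly_at emb Q w * poly_at emb q w"
    using pq(2,3) by simp
  finally show ?thesis
    using pq(2) by simp
qed

lemma subst_is_unique:
  assumes "field_hom emb" "subst_is emb r w s" "subst_is emb r w s'"
  shows "s = s'"
proof -
  interpret ev: comm_ring_hom "\<lambda>p. poly_at emb p w"
    using assms(1) by (rule poly_at_comm_ring_hom)
  obtain p q where pq: "r = Fract p q" "poly_at emb q w \<noteq> 0"
    "s = poly_at emb p w / poly_at emb q w"
    using assms(2) by (auto simp: subst_is_def)
  moreover have "poly_at emb p w = s' * poly_at emb q w"
    using assms pq by (intro subst_is_Fract) auto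
  ultimately show ?thesis
    by simp
qed

lemma pullback_eqI: "field_hom emb \<Longrightarrow> subst_is emb r w s \<Longrightarrow> pullback emb w r = s"
  unfolding pullback_def using subst_is_unique by (intro the_equality) blast+

lemma pullback_Fract:
  assumes "field_hom emb" "dominant emb w" "q \<noteq> 0"
  shows "pullback emb w (Fract p q) = poly_at emb p w / poly_at emb q w"
  using assms by (intro pullback_eqI) (auto simp: subst_is_def dominant_def)

lemma extends_pullback:
  assumes emb: "field_hom emb" and w: "dominant emb w"
  shows "extends emb (pullback emb w)"
    and "pullback emb w X = fst w" "pullback emb w Y = snd w"
proof -
  interpret emb: field_hom emb by fact
  interpret ev: comm_ring_hom "\<lambda>p. poly_at emb p w"
    using emb by (rule poly_at_comm_ring_hom)
  note eval = pullback_Fract[OF emb w]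
  have nz: "q \<noteq> 0 \<Longrightarrow> poly_at emb q w \<noteq> 0" for q
    using w by (simp add: dominant_def)
  have const: "pullback emb w (const2 c) = emb c" for c
    by (simp add: const2_def eval) (simp add: poly_at_def Polynomial.map_poly_pCons)
  have "pullback emb w (r + s) = pullback emb w r + pullback emb w s" for r s
    by (cases r; cases s) (simp add: eval nz ev.hom_add ev.hom_mult add_frac_eq)
  moreover have "pullback emb w (r * s) = pullback emb w r * pullback emb w s" for r s
    by (cases r; cases s) (simp add: eval nz ev.hom_mult)
  moreover have "pullback emb w 0 = 0" "pullback emb w 1 = 1"
    using const[of 0] const[of 1] by simp_all
  ultimately have "field_hom (pullback emb w)"
    by unfold_locales
  then show "extends emb (pullback emb w)"
    using const by (simp add: extends_def)
  show "pullback emb w X = fst w" "pullback emb w Y = snd w"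
    by (simp_all add: X_def Y_def eval) (simp_all add: poly_at_def Polynomial.map_poly_pCons)
qed

lemma extends_poly_at:
  assumes "extends emb h"
  shows "h (poly_at const2 p (a, b)) = poly_at emb p (h a, h b)"
  using poly_at_field_hom[OF const2.field_hom_axioms, of h p "(a, b)"] assms
  by (simp add: extends_def)

lemma
  assumes emb: "field_hom emb" and h: "extends emb h"
  shows extends_dominant: "dominant emb (h X, h Y)"
    and extends_subst_is: "subst_is emb r (h X, h Y) (h r)"
    and extends_eq_pullback: "pullback emb (h X, h Y) = h"
proof -
  interpret h: field_hom h
    using h by (simp add: extends_def)
  have ev: "poly_at emb p (h X, h Y) = h (Fract p 1)" for p
    by (simp add: poly_at_X_Y flip: extends_poly_at[OF h])
  show dom: "dominant emb (h X, h Y)"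
    by (simp add: dominant_def ev Zero_fract_def eq_fract)
  have "subst_is emb r (h X, h Y) (h r)" for r
  proof -
    obtain p q where pq: "r = Fract p q" "q \<noteq> 0"
      by (cases r)
    have "h r = h (Fract p 1) / h (Fract q 1)"
      by (simp add: pq(1) flip: h.hom_div)
    then show ?thesis
      using pq dom by (auto simp: subst_is_def dominant_def simp flip: ev)
  qed
  then show "subst_is emb r (h X, h Y) (h r)" "pullback emb (h X, h Y) = h"
    using pullback_eqI[OF emb] by auto
qed

lemma extends_ext:
  assumes "field_hom emb" "extends emb h" "extends emb h'" "h X = h' X" "h Y = h' Y"
  shows "h = h'"
  using extends_eq_pullback assms by metis

lemma extends_comp:
  assumes "extends const2 g" "extends emb h"
  shows "extends emb (\<lambda>r. h (g r))"
proof -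
  interpret g: field_hom g using assms by (simp add: extends_def)
  interpret h: field_hom h using assms by (simp add: extends_def)
  have "field_hom (\<lambda>r. h (g r))"
    by unfold_locales (simp_all add: g.hom_add g.hom_mult h.hom_add h.hom_mult)
  then show ?thesis
    using assms by (simp add: extends_def)
qed

text \<open>
Specialising \<open>z\<close> commutes with substitution, as long as the specialised point is dominant: then no
denominator vanishes there.
\<close>

lemma value_at_subst_is:
  assumes "subst_is const3 r (a, b) s" "value_at e a a'" "value_at e b b'"
    and "dominant const2 (a', b')"
  shows "value_at e s (pullback const2 (a', b') r)"
proof -
  obtain p q where pq: "r = Fract p q" "poly_at const3 q (a, b) \<noteq> 0"
    "s = poly_at const3 p (a, b) / poly_at const3 q (a, b)"
    using assms(1) by (auto simp: subst_is_def)
  interpret ev: comm_ring_hom "\<lambda>p. poly_at const3 p (a, b)"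
    by (rule poly_at_comm_ring_hom) unfold_locales
  have "q \<noteq> 0"
    using pq(2) by auto
  then have "poly_at const2 q (a', b') \<noteq> 0"
    using assms(4) by (simp add: dominant_def)
  then show ?thesis
    using \<open>q \<noteq> 0\<close> assms(2-4)
    by (simp add: pq pullback_Fract const2.field_hom_axioms value_at_divide value_at_poly_at)
qed

section \<open>Scalings\<close>

definition scaling :: "real \<Rightarrow> rat2 \<Rightarrow> rat2" where
  "scaling c = pullback const2 (const2 c * X, const2 c * Y)"

text \<open>
Rescaling the variables multiplies each coefficient of a polynomial by a power of \<open>c\<close>.
\<close>

lemma dominant_scaling:
  assumes "c \<noteq> 0"
  shows "dominant const2 (const2 c * X, const2 c * Y)"
  unfolding dominant_def
proof (intro allI impI notI)
  fix p assume "p \<noteq> 0" "poly_at const2 p (const2 c * X, const2 c * Y) = 0"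
  define q where "q = (\<Sum>k\<le>degree_bound p. smult [:c ^ k:] (homogeneous_part k p))"
  have "const2 d * Fract u 1 = Fract (smult [:d:] u) 1" for d u
    by (simp add: const2_def)
  then have "poly_at const2 p (const2 c * X, const2 c * Y) = Fract q 1"
    by (simp add: poly_at_scale[OF const2.field_hom_axioms] poly_at_X_Y q_def sum_Fract
        flip: const2.hom_power)
  then have "q = 0"
    using \<open>poly_at const2 p _ = 0\<close> by (simp add: Zero_fract_def eq_fract)
  have "coeff (coeff q j) i = c ^ (i + j) * coeff (coeff p j) i" for i j
    by (simp add: q_def coeff_sum coeff_homogeneous_part if_distrib coeff_eq_0_degree_bound not_le
        cong: if_cong)
  then have "coeff (coeff p j) i = 0" for i j
    using \<open>q = 0\<close> assms by simp
  then have "p = 0"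
    by (intro poly_eqI) simp
  with \<open>p \<noteq> 0\<close> show False ..
qed

lemma
  assumes "c \<noteq> 0"
  shows extends_scaling: "extends const2 (scaling c)"
    and scaling_X: "scaling c X = const2 c * X"
    and scaling_Y: "scaling c Y = const2 c * Y"
  using extends_pullback[OF const2.field_hom_axioms dominant_scaling[OF assms]]
  by (simp_all add: scaling_def[abs_def])

lemma scaling_scaling:
  assumes "c \<noteq> 0" "d \<noteq> 0"
  shows "scaling c (scaling d r) = scaling (c * d) r"
proof -
  interpret field_hom "scaling c"
    using extends_scaling[OF assms(1)] by (simp add: extends_def)
  have [simp]: "scaling c (const2 e) = const2 e" for e
    using extends_scaling[OF assms(1)] by (simp add: extends_def)
  have "(\<lambda>r. scaling c (scaling d r)) = scaling (c * d)"
  proof (rule extends_ext[OF const2.field_hom_axioms])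
    show "extends const2 (\<lambda>r. scaling c (scaling d r))"
      using assms extends_comp extends_scaling by blast
    show "extends const2 (scaling (c * d))"
      using assms by (simp add: extends_scaling)
  qed (use assms in \<open>simp_all add: scaling_X scaling_Y hom_mult const2.hom_mult ac_simps\<close>)
  then show ?thesis
    by (rule fun_cong)
qed

lemma scaling_one: "scaling 1 r = r"
proof -
  have "extends const2 (\<lambda>r. r)"
    unfolding extends_def by (intro conjI) (unfold_locales, simp_all)
  then have "scaling 1 = (\<lambda>r. r)"
    by (intro extends_ext[OF const2.field_hom_axioms] extends_scaling)
      (simp_all add: scaling_X scaling_Y)
  then show ?thesis
    by simp
qed

text \<open>
Homogeneity of degree \<open>d\<close>, tested only at real factors. This suffices, since \<open>\<real>\<close> is infinite, and
it involves only endomorphisms of \<open>\<real>(x, y)\<close>.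
\<close>

definition scales_with :: "nat \<Rightarrow> rat2 \<Rightarrow> bool" where
  "scales_with d r \<longleftrightarrow> (\<forall>c. c \<noteq> 0 \<longrightarrow> scaling c r = const2 c ^ d * r)"

text \<open>
Both sides are polynomials in \<open>z\<close> that agree at all nonzero real constants. Once the identity holds
for polynomials, it can be evaluated at the variable \<open>z\<close> and at any element of \<open>\<real>(x, y)\<close>.
\<close>

lemma scale_poly_homogeneous:
  assumes "scales_with d (Fract p q)" "q \<noteq> 0"
  shows "scale_poly p (X, Y) = monom (Fract p q) d * scale_poly q (X, Y)"
proof (rule poly_eqI_const2[of "{0}"])
  fix c :: real
  assume "c \<notin> {0}"
  then have "c \<noteq> 0" by simp
  have "poly_at const2 q (const2 c * X, const2 c * Y) \<noteq> 0"
    using dominant_scaling[OF \<open>c \<noteq> 0\<close>] assms(2) by (simp add: dominant_def)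
  moreover have "scaling c (Fract p q) = const2 c ^ d * Fract p q"
    using assms(1) \<open>c \<noteq> 0\<close> by (simp add: scales_with_def)
  ultimately show "poly (scale_poly p (X, Y)) (const2 c) =
      poly (monom (Fract p q) d * scale_poly q (X, Y)) (const2 c)"
    using pullback_Fract[OF const2.field_hom_axioms dominant_scaling[OF \<open>c \<noteq> 0\<close>] assms(2), of p,
        folded scaling_def]
    by (simp add: poly_scale_poly poly_monom field_simps)
qed simp

lemma scale_poly_nonzero: "p \<noteq> 0 \<Longrightarrow> scale_poly p (X, Y) \<noteq> 0"
  using poly_scale_poly[of p X Y 1] by (auto simp: poly_at_X_Y Zero_fract_def eq_fract)

lemma homogeneous_of_scales_with:
  assumes "scales_with d r"
  shows "homogeneous (int d) r"
proof -
  obtain p q where pq: "r = Fract p q" "q \<noteq> 0"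
    by (cases r)
  define P Q where "P = scale_poly p (X, Y)" and "Q = scale_poly q (X, Y)"
  have PQ: "P = monom r d * Q" "Q \<noteq> 0"
    using scale_poly_homogeneous scale_poly_nonzero assms pq by (auto simp: P_def Q_def)
  have "poly_at const3 q (Z * lift3 X, Z * lift3 Y) \<noteq> 0"
    using PQ by (simp add: poly_at_scale_Z Q_def[symmetric] Zero_fract_def eq_fract)
  moreover have "Z ^ d * lift3 r = poly_at const3 p (Z * lift3 X, Z * lift3 Y) /
      poly_at const3 q (Z * lift3 X, Z * lift3 Y)"
    using PQ by (simp add: poly_at_scale_Z P_def[symmetric] Q_def[symmetric]
        Z_power_mult_lift3 eq_fract)
  ultimately show ?thesis
    using pq(1) by (auto simp: homogeneous_def subst_is_def scale_def)
qed

lemma pullback_homogeneous: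
  assumes "scales_with d r" "dominant const2 (e * X, e * Y)"
  shows "pullback const2 (e * X, e * Y) r = e ^ d * r"
proof -
  obtain p q where pq: "r = Fract p q" "q \<noteq> 0"
    by (cases r)
  have "poly (scale_poly p (X, Y)) e = poly (monom r d * scale_poly q (X, Y)) e"
    using scale_poly_homogeneous assms(1) pq by simp
  then have "poly_at const2 p (e * X, e * Y) = e ^ d * r * poly_at const2 q (e * X, e * Y)"
    by (simp add: poly_scale_poly poly_monom mult.commute)
  moreover have "poly_at const2 q (e * X, e * Y) \<noteq> 0"
    using assms(2) pq(2) by (simp add: dominant_def)
  ultimately show ?thesis
    using pq pullback_Fract[OF const2.field_hom_axioms assms(2) pq(2), of p] by simp
qed

text \<open>
A relation \<open>p(B x, B y) = 0\<close> can be rescaled to \<open>p(z B x, z B y) = 0\<close> for every \<open>z\<close>, because \<open>B\<close> is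
invariant; the choice \<open>z = 1 / B\<close> gives \<open>p = 0\<close>.
\<close>

lemma dominant_homothety:
  assumes "scales_with 0 B" "B \<noteq> 0"
  shows "dominant const2 (B * X, B * Y)"
  unfolding dominant_def
proof (intro allI impI notI)
  fix p assume "p \<noteq> 0" and zero: "poly_at const2 p (B * X, B * Y) = 0"
  have "scale_poly p (B * X, B * Y) = 0"
  proof (rule poly_eqI_const2[of "{0}"])
    fix c :: real
    assume "c \<notin> {0}"
    then have c: "c \<noteq> 0" by simp
    interpret field_hom "scaling c"
      using extends_scaling[OF c] by (simp add: extends_def)
    have "scaling c (poly_at const2 p (B * X, B * Y)) =
        poly_at const2 p (const2 c * (B * X), const2 c * (B * Y))"
      using assms(1) c
      by (simp add: extends_poly_at[OF extends_scaling[OF c]] hom_mult scaling_X scaling_Y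
          scales_with_def mult.left_commute)
    then show "poly (scale_poly p (B * X, B * Y)) (const2 c) = poly 0 (const2 c)"
      using zero by (simp add: poly_scale_poly)
  qed simp
  then have "poly_at const2 p (inverse B * (B * X), inverse B * (B * Y)) = 0"
    by (simp flip: poly_scale_poly)
  then have "poly_at const2 p (X, Y) = 0"
    using assms(2) by (simp flip: mult.assoc)
  with \<open>p \<noteq> 0\<close> show False
    by (simp add: poly_at_X_Y Zero_fract_def eq_fract)
qed

lemma extends_comp_is:
  assumes "extends const2 h"
  shows "comp_is f (h X, h Y) (h (fst f), h (snd f))"
  by (simp add: comp_is_def map_subst_is_def extends_subst_is[OF const2.field_hom_axioms assms])

section \<open>Rational flows\<close>

lemma Z_nonzero: "Z \<noteq> 0"
  by (simp add: Z_def Zero_fract_def eq_fract)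

lemma dominant_scaling_Z: "dominant const3 (Z * lift3 X, Z * lift3 Y)"
  using scale_poly_nonzero
  by (simp add: dominant_def poly_at_scale_Z Zero_fract_def eq_fract)

lemma rational_flow_cases:
  assumes "rational_flow \<phi>"
  obtains u v \<psi>\<^sub>1 \<psi>\<^sub>2 where "\<phi> = (u, v)" "u \<noteq> X \<or> v \<noteq> Y"
    "subst_is const3 u (Z * lift3 X, Z * lift3 Y) \<psi>\<^sub>1"
    "subst_is const3 v (Z * lift3 X, Z * lift3 Y) \<psi>\<^sub>2"
    "subst_is const3 u ((1 - Z) / Z * \<psi>\<^sub>1, (1 - Z) / Z * \<psi>\<^sub>2) ((1 - Z) * lift3 u)"
    "subst_is const3 v ((1 - Z) / Z * \<psi>\<^sub>1, (1 - Z) / Z * \<psi>\<^sub>2) ((1 - Z) * lift3 v)"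
    "value_at 0 (\<psi>\<^sub>1 / Z) X" "value_at 0 (\<psi>\<^sub>2 / Z) Y"
proof -
  obtain u v where "\<phi> = (u, v)"
    by (cases \<phi>)
  with assms that show thesis
    by (auto simp: rational_flow_def map_subst_is_def scale_def lim_Z_0_is_iff)
qed

text \<open>
Suppose that \<open>p(u, v) = 0\<close>. Replacing \<open>x, y\<close> by \<open>x z, y z\<close> and writing \<open>(u, v)(x z, y z)\<close> as \<open>z g\<close>,
where \<open>g\<close> tends to \<open>(x, y)\<close>, turns this into the relation \<open>\<Sum>\<^sub>k z\<^sup>k p\<^sub>k(g) = 0\<close> for the
homogeneous parts \<open>p\<^sub>k\<close> of \<open>p\<close>. Divide by the lowest power \<open>z\<^sup>m\<close> that occurs and let \<open>z\<close> tend to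
\<open>0\<close>: the result is \<open>p\<^sub>m(x, y) = 0\<close>, although \<open>p\<^sub>m \<noteq> 0\<close>.
\<close>

lemma flow_dominant:
  assumes subst: "subst_is const3 u (Z * lift3 X, Z * lift3 Y) \<psi>\<^sub>1"
    "subst_is const3 v (Z * lift3 X, Z * lift3 Y) \<psi>\<^sub>2"
    and lim: "value_at 0 (\<psi>\<^sub>1 / Z) X" "value_at 0 (\<psi>\<^sub>2 / Z) Y"
  shows "dominant const2 (u, v)"
  unfolding dominant_def
proof (intro allI impI notI)
  fix p assume "p \<noteq> 0" and zero: "poly_at const2 p (u, v) = 0"
  interpret ev2: comm_ring_hom "\<lambda>p. poly_at const2 p w" for w
    by (rule poly_at_comm_ring_hom[OF const2.field_hom_axioms])
  interpret ev3: comm_ring_hom "\<lambda>p. poly_at const3 p w" for w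
    by (rule poly_at_comm_ring_hom[OF const3.field_hom_axioms])
  let ?S = "pullback const3 (Z * lift3 X, Z * lift3 Y)"
  have S: "extends const3 ?S" "?S u = \<psi>\<^sub>1" "?S v = \<psi>\<^sub>2"
    using extends_pullback(1) pullback_eqI const3.field_hom_axioms dominant_scaling_Z subst by auto
  then interpret S: field_hom ?S
    by (simp add: extends_def)
  have "(\<Sum>k\<le>degree_bound p. homogeneous_part k p) \<noteq> 0"
    using \<open>p \<noteq> 0\<close> by (simp add: sum_homogeneous_part)
  then obtain k\<^sub>0 where k0: "k\<^sub>0 \<le> degree_bound p" "homogeneous_part k\<^sub>0 p \<noteq> 0"
    by (metis (no_types, lifting) atMost_iff sum.neutral)
  define m where "m = (LEAST k. homogeneous_part k p \<noteq> 0)"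
  have m: "homogeneous_part m p \<noteq> 0" "m \<le> degree_bound p"
    using LeastI[of "\<lambda>k. homogeneous_part k p \<noteq> 0"] Least_le[of "\<lambda>k. homogeneous_part k p \<noteq> 0"] k0
    unfolding m_def by (blast intro: le_trans)+
  have below: "homogeneous_part k p = 0" if "k < m" for k
    using not_less_Least that unfolding m_def by blast
  define G where "G k = poly_at const3 (homogeneous_part k p) (\<psi>\<^sub>1 / Z, \<psi>\<^sub>2 / Z)" for k
  define H where "H k = poly_at const2 (homogeneous_part k p) (X, Y)" for k
  have "0 = poly_at const3 p (Z * (\<psi>\<^sub>1 / Z), Z * (\<psi>\<^sub>2 / Z))"
    using extends_poly_at[OF S(1), of p u v] zero Z_nonzero by (simp add: S)
  also have "\<dots> = (\<Sum>k\<le>degree_bound p. Z ^ k * G k)"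
    by (simp only: poly_at_scale[OF const3.field_hom_axioms] G_def)
  also have "\<dots> = (\<Sum>k\<le>degree_bound p. Z ^ m * (Z ^ (k - m) * G k))"
  proof (intro sum.cong refl)
    fix k
    show "Z ^ k * G k = Z ^ m * (Z ^ (k - m) * G k)"
      by (cases "k < m") (simp_all add: G_def below flip: mult.assoc power_add)
  qed
  also have "\<dots> = Z ^ m * (\<Sum>k\<le>degree_bound p. Z ^ (k - m) * G k)"
    by (simp only: sum_distrib_left)
  finally have "(\<Sum>k\<le>degree_bound p. Z ^ (k - m) * G k) = 0"
    using Z_nonzero by simp
  moreover have "value_at 0 (\<Sum>k\<le>degree_bound p. Z ^ (k - m) * G k)
      (\<Sum>k\<le>degree_bound p. 0 ^ (k - m) * H k)"
    unfolding G_def H_def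
    by (intro value_at_sum value_at_mult value_at_power value_at_Z value_at_poly_at lim)
  moreover have "value_at 0 0 (0 :: rat2)"
    using value_at_lift3[of 0 0] by simp
  ultimately have "(\<Sum>k\<le>degree_bound p. 0 ^ (k - m) * H k) = 0"
    using value_at_unique by metis
  also have "(\<Sum>k\<le>degree_bound p. 0 ^ (k - m) * H k) = (\<Sum>k\<le>degree_bound p. if k = m then H m else 0)"
  proof (intro sum.cong refl)
    fix k
    show "0 ^ (k - m) * H k = (if k = m then H m else 0)"
      by (cases k m rule: linorder_cases) (simp_all add: H_def below)
  qed
  finally have "H m = 0"
    using m(2) by simp
  then show False
    using m(1) by (simp add: H_def poly_at_X_Y Zero_fract_def eq_fract)
qed

lemma value_at_scaling:
  assumes "subst_is const3 f (Z * lift3 X, Z * lift3 Y) \<psi>" "c \<noteq> 0"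
  shows "value_at (const2 c) \<psi> (scaling c f)"
  unfolding scaling_def
  by (intro value_at_subst_is[OF assms(1)] value_at_mult value_at_Z value_at_lift3
      dominant_scaling assms(2))

lemma value_at_1_minus_Z: "value_at e (1 - Z) (1 - e)"
proof -
  have "[:1 :: rat2:] - [:0, 1:] = [:1, -1:]"
    by (simp del: pCons_one)
  then have "1 - [:0, 1 :: rat2:] = [:1, -1:]"
    by (simp only: pCons_one)
  moreover have "1 - Z = Fract (1 - [:0, 1:]) 1"
    unfolding Z_def One_fract_def[where 'a = "rat2 poly"] by simp
  ultimately have "1 - Z = Fract [:1, -1:] 1"
    by (simp only:)
  then show ?thesis
    using value_at_poly[of e "[:1, -1:]"] by simp
qed

text \<open>
For a coordinate \<open>f\<close> of \<open>\<phi> = (u, v)\<close>, this is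
\<open>f(t \<phi>(x, y)) / t = f((1 + t) (x, y)) / (1 + t)\<close>: following the flow
\<open>s \<mapsto> \<phi>(s x, s y) / s\<close> for time \<open>1\<close> and then for time \<open>t\<close> is the same as following it for time
\<open>1 + t\<close>. The translation equation at \<open>z = c\<close> concerns the times \<open>c\<close> and \<open>1 - c\<close>; rescaling the
variables by \<open>1 / c\<close> turns these into \<open>1\<close> and \<open>(1 - c) / c\<close>.
\<close>

lemma flow_translation:
  assumes subst: "subst_is const3 u (Z * lift3 X, Z * lift3 Y) \<psi>\<^sub>1"
    "subst_is const3 v (Z * lift3 X, Z * lift3 Y) \<psi>\<^sub>2"
    and eq: "subst_is const3 f ((1 - Z) / Z * \<psi>\<^sub>1, (1 - Z) / Z * \<psi>\<^sub>2) ((1 - Z) * lift3 f)"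
    and dom: "dominant const2 (u, v)"
    and t: "t \<noteq> 0" "t \<noteq> -1"
  shows "pullback const2 (u, v) (scaling t f) = const2 (t / (1 + t)) * scaling (1 + t) f"
proof -
  \<comment> \<open>the constant with \<open>(1 - c) / c = t\<close>\<close>
  define c where "c = 1 / (1 + t)"
  have "1 + t \<noteq> 0"
    using t(2) by linarith
  then have c: "c \<noteq> 0" "(1 - c) / c = t" "1 - c = t / (1 + t)" "(1 + t) * c = 1"
    by (simp_all add: c_def field_simps)
  let ?\<Phi> = "pullback const2 (u, v)"
  have \<Phi>: "extends const2 ?\<Phi>" "?\<Phi> X = u" "?\<Phi> Y = v"
    using extends_pullback[OF const2.field_hom_axioms dom] by simp_all
  have t_eq: "const2 (1 - c) = 1 - const2 c" "const2 t = (1 - const2 c) / const2 c"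
    by (simp_all add: c(2)[symmetric] const2.hom_div const2.hom_minus del: c(2))
  interpret \<Phi>: field_hom ?\<Phi>
    using \<Phi>(1) by (simp add: extends_def)
  interpret c: field_hom "scaling c"
    using extends_scaling[OF c(1)] by (simp add: extends_def)
  interpret t: field_hom "scaling (1 + t)"
    using extends_scaling[OF \<open>1 + t \<noteq> 0\<close>] by (simp add: extends_def)
  \<comment> \<open>specialised at \<open>c\<close>, the substituted point of the translation equation is \<open>(h x, h y)\<close>\<close>
  define h where "h r = scaling c (?\<Phi> (scaling t r))" for r
  have h: "extends const2 h"
    unfolding h_def[abs_def] using extends_comp extends_scaling c(1) t(1) \<Phi>(1) by blast
  have fix_const: "?\<Phi> (const2 e) = const2 e" "scaling c (const2 e) = const2 e"
      "scaling (1 + t) (const2 e) = const2 e" for e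
    using \<Phi>(1) extends_scaling[OF c(1)] extends_scaling[OF \<open>1 + t \<noteq> 0\<close>] by (simp_all add: extends_def)
  have hXY: "h X = (1 - const2 c) / const2 c * scaling c u"
      "h Y = (1 - const2 c) / const2 c * scaling c v"
    using t(1) by (simp_all add: h_def scaling_X scaling_Y \<Phi>.hom_mult c.hom_mult \<Phi>(2,3) fix_const
        flip: t_eq(2))
  have "value_at (const2 c) ((1 - Z) * lift3 f) (pullback const2 (h X, h Y) f)"
  proof (rule value_at_subst_is[OF eq])
    show "value_at (const2 c) ((1 - Z) / Z * \<psi>\<^sub>1) (h X)"
      "value_at (const2 c) ((1 - Z) / Z * \<psi>\<^sub>2) (h Y)"
      unfolding hXY using c(1)
      by (intro value_at_mult value_at_divide value_at_1_minus_Z value_at_Z value_at_scaling subst; simp)+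
    show "dominant const2 (h X, h Y)"
      by (rule extends_dominant[OF const2.field_hom_axioms h])
  qed
  then have "value_at (const2 c) ((1 - Z) * lift3 f) (h f)"
    by (simp only: extends_eq_pullback[OF const2.field_hom_axioms h])
  moreover have "value_at (const2 c) ((1 - Z) * lift3 f) ((1 - const2 c) * f)"
    by (intro value_at_mult value_at_1_minus_Z value_at_lift3)
  ultimately have "h f = const2 (1 - c) * f"
    using value_at_unique t_eq(1) by metis
  then have "scaling (1 + t) (h f) = const2 (1 - c) * scaling (1 + t) f"
    by (simp add: t.hom_mult fix_const)
  moreover have "scaling (1 + t) (h f) = ?\<Phi> (scaling t f)"
    using c(1) \<open>1 + t \<noteq> 0\<close> by (simp add: h_def scaling_scaling c(4) scaling_one)
  ultimately show ?thesis
    by (simp add: c(3))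
qed

section \<open>The time function of a flow\<close>

text \<open>
The assumption on values says that \<open>h\<close>, applied to the coefficients of \<open>P / Q\<close>, gives the same
rational function as the substitution of \<open>a + b z\<close>, up to the factor \<open>k\<close>. By uniqueness of lowest
terms, the numerators and the denominators correspond.
\<close>

lemma lowest_terms_extends:
  assumes PQ: "lowest_terms P Q" and h: "extends const2 h" and bk: "b \<noteq> 0" "k \<noteq> 0"
    and "finite B"
    and eq: "\<And>c. c \<notin> B \<Longrightarrow> h (poly P (const2 c)) * poly Q (const2 (a + b * c)) =
      const2 k * poly P (const2 (a + b * c)) * h (poly Q (const2 c))"
  shows "map_poly h P = smult (const2 k / const2 b ^ degree Q) (P \<circ>\<^sub>p [:const2 a, const2 b:])"
    and "map_poly h Q = smult (1 / const2 b ^ degree Q) (Q \<circ>\<^sub>p [:const2 a, const2 b:])"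
proof -
  interpret h: field_hom h
    using h by (simp add: extends_def)
  define l where "l = [:const2 a, const2 b:]"
  have "poly (map_poly h p) (const2 c) = h (poly p (const2 c))" for p c
    using h by (metis extends_def h.poly_map_poly)
  then have eq': "map_poly h P * Q \<circ>\<^sub>p l = smult (const2 k) (P \<circ>\<^sub>p l) * map_poly h Q"
    using \<open>finite B\<close> eq
    by (intro poly_eqI_const2[of B])
      (simp_all add: l_def poly_pcompose const2.hom_add const2.hom_mult mult.commute)
  let ?P = "smult (const2 k / const2 b ^ degree Q) (P \<circ>\<^sub>p l)"
  let ?Q = "smult (1 / const2 b ^ degree Q) (Q \<circ>\<^sub>p l)"
  have "lowest_terms ?P ?Q"
    unfolding l_def using bk by (intro lowest_terms_pcompose_linear PQ) simp_all
  moreover have "lead_coeff (map_poly h Q) = 1"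
    using PQ by (simp add: lowest_terms_def)
  moreover have "degree (map_poly h Q) = degree ?Q"
    using bk by (simp add: l_def degree_pcompose)
  moreover have "map_poly h P * ?Q = ?P * map_poly h Q"
    using eq' by (simp add: field_simps)
  ultimately have "map_poly h P = ?P \<and> map_poly h Q = ?Q"
    by (rule lowest_terms_unique)
  then show "map_poly h P = smult (const2 k / const2 b ^ degree Q) (P \<circ>\<^sub>p [:const2 a, const2 b:])"
    "map_poly h Q = smult (1 / const2 b ^ degree Q) (Q \<circ>\<^sub>p [:const2 a, const2 b:])"
    by (simp_all add: l_def)
qed

text \<open>
Here \<open>r\<close> stands for \<open>f(x z, y z) / z\<close>, known through its values at real constants. Both the flow and
the scalings act on \<open>r\<close> by affine substitutions of \<open>z\<close> and constant factors, and hence act in the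
same way on a nonconstant one among the numerator and the denominator of \<open>r\<close>.
\<close>

lemma exists_time_function:
  assumes \<Phi>: "extends const2 \<Phi>"
    and val: "\<And>c. c \<noteq> 0 \<Longrightarrow> value_at (const2 c) r (scaling c f / const2 c)"
    and transl: "\<And>t. t \<noteq> 0 \<Longrightarrow> t \<noteq> -1 \<Longrightarrow>
      \<Phi> (scaling t f) = const2 (t / (1 + t)) * scaling (1 + t) f"
    and nontrivial: "\<not> scales_with 1 f"
  obtains W where "\<Phi> W = W + 1" "\<And>c. c \<noteq> 0 \<Longrightarrow> scaling c W = W / const2 c"
proof -
  obtain p q where pq: "r = Fract p q" "q \<noteq> 0"
    by (cases r)
  obtain P Q where PQ: "lowest_terms P Q" "P * q = p * Q"
    using lowest_terms_exist[OF pq(2)] by metis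
  have Q: "Q \<noteq> 0" "lead_coeff Q = 1"
    using PQ(1) by (auto simp: lowest_terms_def)
  have "r = Fract P Q"
    using pq PQ(2) Q(1) by (simp add: eq_fract)
  define g where "g c = scaling c f / const2 c" for c
  have P_eq: "poly P (const2 c) = g c * poly Q (const2 c)" if "c \<noteq> 0" for c
    using val[OF that] Q(1) unfolding \<open>r = Fract P Q\<close> g_def by (rule value_at_Fract)
  have "degree P > 0 \<or> degree Q > 0"
  proof (rule ccontr)
    assume "\<not> ?thesis"
    then obtain a b where "P = [:a:]" "Q = [:b:]"
      by (metis degree_eq_zeroE neq0_conv)
    then have g: "g c = a" if "c \<noteq> 0" for c
      using P_eq[OF that] Q(2) by simp
    have "scaling c f = const2 c ^ 1 * f" if "c \<noteq> 0" for c
      using g[OF that] g[of 1] that by (simp add: g_def scaling_one field_simps)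
    with nontrivial show False
      by (simp add: scales_with_def)
  qed
  then obtain T where T: "T \<in> {P, Q}" "degree T > 0"
    by blast
  have char0: "(of_nat (degree T) :: rat2) \<noteq> 0"
    using T(2) const2.hom_of_nat[of "degree T"] by (metis const2.hom_0_iff neq0_conv of_nat_eq_0_iff)
  have transform: "h (neg_root_mean T) = (neg_root_mean T + const2 a) / const2 b"
    if h: "extends const2 h" and b: "b \<noteq> 0"
      and g: "\<And>c. c \<noteq> 0 \<Longrightarrow> a + b * c \<noteq> 0 \<Longrightarrow> h (g c) = const2 k * g (a + b * c)" and k: "k \<noteq> 0"
    for h a b k
  proof -
    interpret h: field_hom h
      using h by (simp add: extends_def)
    \<comment> \<open>left out: the constants at which \<open>g\<close> does not give the values of \<open>P / Q\<close> at \<open>c\<close> and \<open>a + b c\<close>\<close>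
    have "h (poly P (const2 c)) * poly Q (const2 (a + b * c)) =
        const2 k * poly P (const2 (a + b * c)) * h (poly Q (const2 c))"
      if "c \<notin> {0, - a / b}" for c
    proof -
      have c: "c \<noteq> 0" "a + b * c \<noteq> 0"
        using that b by (auto simp: field_simps add_eq_0_iff)
      show ?thesis
        by (simp add: P_eq[OF c(1)] P_eq[OF c(2)] h.hom_mult g[OF c])
    qed
    note cross = this
    have "finite {0, - a / b}"
      by simp
    note map = lowest_terms_extends[OF PQ(1) h b k this cross]
    have "\<exists>k'. map_poly h T = smult k' (T \<circ>\<^sub>p [:const2 a, const2 b:])"
    proof (cases "T = P")
      case True
      show ?thesis
        unfolding True by (rule exI, rule map(1))
    next
      case False
      then have "T = Q"
        using T(1) by simp
      show ?thesis
        unfolding \<open>T = Q\<close> by (rule exI, rule map(2))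
    qed
    then obtain k' where "map_poly h T = smult k' (T \<circ>\<^sub>p [:const2 a, const2 b:])"
      by blast
    then show ?thesis
      using neg_root_mean_map_poly[OF h.field_hom_axioms _ _ T(2) char0] b by simp
  qed
  have "\<Phi> (neg_root_mean T) = (neg_root_mean T + const2 1) / const2 1"
  proof (rule transform[OF \<Phi>, of 1 1 1])
    fix c :: real assume c: "c \<noteq> 0" "1 + 1 * c \<noteq> 0"
    interpret \<Phi>: field_hom \<Phi>
      using \<Phi> by (simp add: extends_def)
    have "\<Phi> (const2 c) = const2 c"
      using \<Phi> by (simp add: extends_def)
    moreover have "\<Phi> (scaling c f) = const2 (c / (1 + c)) * scaling (1 + c) f"
      using c by (intro transl) auto
    ultimately show "\<Phi> (g c) = const2 1 * g (1 + 1 * c)"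
      using c by (simp add: g_def \<Phi>.hom_div const2.hom_div)
  qed simp_all
  moreover have "scaling e (neg_root_mean T) = (neg_root_mean T + const2 0) / const2 e" if "e \<noteq> 0" for e
  proof (rule transform[OF extends_scaling[OF that], of e 0 e])
    fix c :: real assume c: "c \<noteq> 0" "0 + e * c \<noteq> 0"
    interpret e: field_hom "scaling e"
      using extends_scaling[OF that] by (simp add: extends_def)
    have "scaling e (const2 c) = const2 c"
      using extends_scaling[OF that] by (simp add: extends_def)
    then show "scaling e (g c) = const2 e * g (0 + e * c)"
      using c that by (simp add: g_def e.hom_div scaling_scaling const2.hom_mult)
  qed (use that in simp_all)
  ultimately show thesis
    using that[of "neg_root_mean T"] by simp
qed

text \<open>
If \<open>f\<close> is homogeneous of degree \<open>1\<close>, then \<open>f(x z, y z) / z = f\<close> does not depend on \<open>z\<close> and equals its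
limit at \<open>z = 0\<close>.
\<close>

lemma coordinate_trivial:
  assumes "subst_is const3 f (Z * lift3 X, Z * lift3 Y) \<psi>" "value_at 0 (\<psi> / Z) x" "scales_with 1 f"
  shows "f = x"
proof -
  have "subst_is const3 f (Z * lift3 X, Z * lift3 Y) (Z * lift3 f)"
    using homogeneous_of_scales_with[OF assms(3)] by (simp add: homogeneous_def scale_def)
  then have "\<psi> = Z * lift3 f"
    using assms(1) subst_is_unique[OF const3.field_hom_axioms] by blast
  then have "value_at 0 (lift3 f) x"
    using assms(2) Z_nonzero by simp
  then show ?thesis
    using value_at_lift3 value_at_unique by blast
qed

section \<open>The normal form\<close>

theorem proposition4:
  fixes \<phi> :: "rat2 \<times> rat2"
  assumes "rational_flow \<phi>"
  shows "\<exists>A l linv \<psi> U.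
           homogeneous 0 A \<and> l = (X * A, Y * A) \<and> one_BIR l \<and> birational_inverse l linv \<and>
           comp_is \<phi> l \<psi> \<and> comp_is linv \<psi> (U, Y / (Y + 1))"
proof -
  obtain u v \<psi>\<^sub>1 \<psi>\<^sub>2 where \<phi>: "\<phi> = (u, v)" "u \<noteq> X \<or> v \<noteq> Y"
    and subst: "subst_is const3 u (Z * lift3 X, Z * lift3 Y) \<psi>\<^sub>1"
      "subst_is const3 v (Z * lift3 X, Z * lift3 Y) \<psi>\<^sub>2"
    and eq: "subst_is const3 u ((1 - Z) / Z * \<psi>\<^sub>1, (1 - Z) / Z * \<psi>\<^sub>2) ((1 - Z) * lift3 u)"
      "subst_is const3 v ((1 - Z) / Z * \<psi>\<^sub>1, (1 - Z) / Z * \<psi>\<^sub>2) ((1 - Z) * lift3 v)"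
    and lim: "value_at 0 (\<psi>\<^sub>1 / Z) X" "value_at 0 (\<psi>\<^sub>2 / Z) Y"
    using assms by (rule rational_flow_cases)
  define \<Phi> where "\<Phi> = pullback const2 (u, v)"
  have dom: "dominant const2 (u, v)"
    using subst lim by (rule flow_dominant)
  have \<Phi>: "extends const2 \<Phi>" "\<Phi> X = u" "\<Phi> Y = v"
    using extends_pullback[OF const2.field_hom_axioms dom] by (simp_all add: \<Phi>_def)
  \<comment> \<open>a coordinate that really depends on time\<close>
  obtain f \<psi> where f: "subst_is const3 f (Z * lift3 X, Z * lift3 Y) \<psi>"
    "subst_is const3 f ((1 - Z) / Z * \<psi>\<^sub>1, (1 - Z) / Z * \<psi>\<^sub>2) ((1 - Z) * lift3 f)"
    "\<not> scales_with 1 f"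
    using \<phi>(2) coordinate_trivial[OF subst(1) lim(1)] coordinate_trivial[OF subst(2) lim(2)]
      subst eq by blast
  have val: "value_at (const2 c) (\<psi> / Z) (scaling c f / const2 c)" if "c \<noteq> 0" for c
    using that by (intro value_at_divide value_at_scaling f(1) value_at_Z) simp_all
  have transl: "\<Phi> (scaling t f) = const2 (t / (1 + t)) * scaling (1 + t) f"
    if "t \<noteq> 0" "t \<noteq> -1" for t
    unfolding \<Phi>_def using that by (intro flow_translation[OF subst f(2) dom])
  obtain W where W: "\<Phi> W = W + 1" "\<And>c. c \<noteq> 0 \<Longrightarrow> scaling c W = W / const2 c"
    using exists_time_function[OF \<Phi>(1) val transl f(3)] by blast
  interpret \<Phi>: field_hom \<Phi>
    using \<Phi>(1) by (simp add: extends_def)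
  have Y: "Y \<noteq> 0"
    by (simp add: Y_def Zero_fract_def eq_fract)
  have "W \<noteq> 0"
    using W(1) by auto
  define A where "A = Y * W"
  have A: "A \<noteq> 0"
    using Y \<open>W \<noteq> 0\<close> by (simp add: A_def)
  have sc: "field_hom (scaling c)" "scaling c A = A" "scaling c (inverse A) = inverse A"
      "scaling c (X * A) = const2 c * (X * A)" "scaling c (Y * A) = const2 c * (Y * A)" if "c \<noteq> 0" for c
  proof -
    show "field_hom (scaling c)"
      using extends_scaling[OF that] by (simp add: extends_def)
    then interpret c: field_hom "scaling c" .
    show A: "scaling c A = A"
      using that by (simp add: A_def c.hom_mult scaling_Y W(2))
    show "scaling c (inverse A) = inverse A"
      "scaling c (X * A) = const2 c * (X * A)" "scaling c (Y * A) = const2 c * (Y * A)"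
      using that by (simp_all add: A c.hom_inverse c.hom_mult scaling_X scaling_Y)
  qed
  have A0: "scales_with 0 A" "scales_with 0 (inverse A)"
    and l1: "scales_with 1 (X * A)" "scales_with 1 (Y * A)"
    using sc by (simp_all add: scales_with_def)
  define L where "L = pullback const2 (A * X, A * Y)"
  define M where "M = pullback const2 (inverse A * X, inverse A * Y)"
  have domL: "dominant const2 (A * X, A * Y)" and domM: "dominant const2 (inverse A * X, inverse A * Y)"
    using dominant_homothety A0 A by auto
  have L: "extends const2 L" "L X = X * A" "L Y = Y * A" "L A = A"
    using extends_pullback[OF const2.field_hom_axioms domL] pullback_homogeneous[OF A0(1) domL]
    by (simp_all add: L_def mult.commute)
  have M: "extends const2 M" "M X = X / A" "M Y = Y / A" "M A = A"
    using extends_pullback[OF const2.field_hom_axioms domM] pullback_homogeneous[OF A0(1) domM]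
    by (simp_all add: M_def field_simps)
  interpret L: field_hom L
    using L(1) by (simp add: extends_def)
  interpret M: field_hom M
    using M(1) by (simp add: extends_def)
  define l where "l = (X * A, Y * A)"
  define linv where "linv = (X / A, Y / A)"
  have inv: "birational_inverse l linv"
    unfolding birational_inverse_def
    using extends_comp_is[OF L(1), of linv] extends_comp_is[OF M(1), of l] A
    by (simp add: l_def linv_def L M L.hom_div M.hom_mult)
  have "L W = 1 / Y"
  proof -
    have "L A = L Y * L W"
      by (simp add: A_def L.hom_mult)
    then show ?thesis
      using L(3,4) A Y by (simp add: field_simps)
  qed
  \<comment> \<open>the composition \<open>r \<circ> \<phi> \<circ> l\<close>: pullbacks compose in the reverse order\<close>
  have "extends const2 (\<lambda>r. L (\<Phi> r))"
    by (rule extends_comp[OF \<Phi>(1) L(1)])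
  from extends_comp_is[OF this, of linv]
  have "comp_is linv (L u, L v) (L (\<Phi> (X / A)), L (\<Phi> (Y / A)))"
    by (simp add: linv_def \<Phi>)
  moreover have "Y / A = 1 / W"
    using Y by (simp add: A_def)
  moreover have "L (\<Phi> (1 / W)) = Y / (Y + 1)"
    using Y by (simp add: \<Phi>.hom_div L.hom_div W(1) L.hom_add \<open>L W = 1 / Y\<close> field_simps)
  ultimately have "comp_is linv (L u, L v) (L (\<Phi> (X / A)), Y / (Y + 1))"
    by simp
  moreover have "comp_is \<phi> l (L u, L v)"
    using extends_comp_is[OF L(1), of \<phi>] by (simp add: \<phi>(1) l_def L)
  moreover have "one_BIR l"
    unfolding one_BIR_def using inv l1[THEN homogeneous_of_scales_with]
    by (intro conjI exI[of _ linv]) (simp_all add: l_def)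
  moreover have "homogeneous 0 A"
    using homogeneous_of_scales_with[OF A0(1)] by simp
  ultimately show ?thesis
    using inv l_def by blast
qed

end
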